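(* Let $a, c, \tau \geqslant 0$ and $\mu > 0$. For a differentiable $\mu$-strongly convex function $f:\mathbf{R}^d\to\mathbf{R}$ with unique minimizer $x_\star$ and $f_\star=f(x_\star)$, and for a trajectory $X_t$, put $$\mathcal{V}_{a,c}(X_t) = a\,(f(X_t)-f_\star) + c\,\|X_t-x_\star\|^2 .$$ The following assertions are equivalent: (i) The inequality $\frac{d}{dt}\mathcal{V}_{a,c}(X_t) \leqslant -\tau\, \mathcal{V}_{a,c}(X_t)$ is satisfied (for all $t \geqslant 0$) for every dimension $d\in\mathbf{N}$, every $f\in\mathcal{F}_{\mu,\infty}$ on $\mathbf{R}^d$, and every trajectory $X_t$ solution to the gradient flow $\dot X_t = -\nabla f(X_t)$, $X_0=x_0\in\mathbf{R}^d$. (ii) There exist $\lambda_1,\lambda_2\geqslant 0$ such that $$\begin{pmatrix} \tau c - \frac{\mu}{2}(\lambda_1+\lambda_2) & -c+\frac{\lambda_1}{2}\\ -c+\frac{\lambda_1}{2} & -a\end{pmatrix}\preccurlyeq 0,\qquad \tau a = \lambda_1-\lambda_2 .$$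
   Context: $\mathcal{F}_{\mu,\infty}$ denotes the family of differentiable $\mu$-strongly convex functions $f:\mathbf{R}^d\to\mathbf{R}$ (no smoothness constant imposed), i.e. $f(x)\geqslant f(y)+\langle\nabla f(y),x-y\rangle+\frac{\mu}{2}\|x-y\|^2$ for all $x,y\in\mathbf{R}^d$. The notation $M\preccurlyeq 0$ means that the symmetric matrix $M$ is negative semidefinite. *)

theory Defs
  imports "HOL-Analysis.Analysis"
begin

text \<open>
  The equivalence quantifies over the dimension inside one of its two sides, so \<open>d\<close> cannot be
  a type. We use the inner product space of finitely supported real sequences, with the
  Euclidean inner product, and take \<open>\<real>\<^sup>d\<close> to be its subspace of sequences that vanish from
  index \<open>d\<close> on. A function on \<open>\<real>\<^sup>d\<close> is a function on the whole type of which only the values on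
  that subspace are ever used; derivatives are taken within the subspace.
\<close>

typedef finseq = "{x :: nat \<Rightarrow> real. finite {i. x i \<noteq> 0}}"
  morphisms coord Finseq
  by (rule exI[of _ "\<lambda>_. 0"]) simp

lemma finite_coord [simp]: "finite {i. coord x i \<noteq> 0}"
  using coord[of x] by simp

lemma coord_Finseq: "finite {i. x i \<noteq> 0} \<Longrightarrow> coord (Finseq x) = x"
  by (simp add: Finseq_inverse)

lemma finseq_eq_iff: "x = y \<longleftrightarrow> (\<forall>i. coord x i = coord y i)"
  by (metis coord_inject ext)

instantiation finseq :: real_vector
begin

definition zero_finseq :: finseq where
  "0 = Finseq (\<lambda>_. 0)"

definition plus_finseq :: "finseq \<Rightarrow> finseq \<Rightarrow> finseq" where
  "x + y = Finseq (\<lambda>i. coord x i + coord y i)"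

definition minus_finseq :: "finseq \<Rightarrow> finseq \<Rightarrow> finseq" where
  "x - y = Finseq (\<lambda>i. coord x i - coord y i)"

definition uminus_finseq :: "finseq \<Rightarrow> finseq" where
  "- x = Finseq (\<lambda>i. - coord x i)"

definition scaleR_finseq :: "real \<Rightarrow> finseq \<Rightarrow> finseq" where
  "r *\<^sub>R x = Finseq (\<lambda>i. r * coord x i)"

lemma coord_zero [simp]: "coord 0 i = 0"
  by (simp add: zero_finseq_def coord_Finseq)

lemma coord_plus [simp]: "coord (x + y) i = coord x i + coord y i"
proof -
  have "finite {i. coord x i + coord y i \<noteq> 0}"
    by (rule finite_subset[of _ "{i. coord x i \<noteq> 0} \<union> {i. coord y i \<noteq> 0}"]) auto
  then show ?thesis by (simp add: plus_finseq_def coord_Finseq)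
qed

lemma coord_minus [simp]: "coord (x - y) i = coord x i - coord y i"
proof -
  have "finite {i. coord x i - coord y i \<noteq> 0}"
    by (rule finite_subset[of _ "{i. coord x i \<noteq> 0} \<union> {i. coord y i \<noteq> 0}"]) auto
  then show ?thesis by (simp add: minus_finseq_def coord_Finseq)
qed

lemma coord_uminus [simp]: "coord (- x) i = - coord x i"
  by (simp add: uminus_finseq_def coord_Finseq)

lemma coord_scaleR [simp]: "coord (r *\<^sub>R x) i = r * coord x i"
proof -
  have "finite {i. r * coord x i \<noteq> 0}"
    by (rule finite_subset[of _ "{i. coord x i \<noteq> 0}"]) auto
  then show ?thesis by (simp add: scaleR_finseq_def coord_Finseq)
qed

instance
  by standard (auto simp: finseq_eq_iff algebra_simps)

end

lemma coord_sum [simp]: "coord (\<Sum>k\<in>A. f k) i = (\<Sum>k\<in>A. coord (f k) i)"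
  by (induction A rule: infinite_finite_induct) auto

instantiation finseq :: real_inner
begin

definition inner_finseq :: "finseq \<Rightarrow> finseq \<Rightarrow> real" where
  "inner x y = (\<Sum>i | coord x i \<noteq> 0. coord x i * coord y i)"

definition norm_finseq :: "finseq \<Rightarrow> real" where
  "norm (x :: finseq) = sqrt (inner x x)"

definition sgn_finseq :: "finseq \<Rightarrow> finseq" where
  "sgn (x :: finseq) = x /\<^sub>R norm x"

definition dist_finseq :: "finseq \<Rightarrow> finseq \<Rightarrow> real" where
  "dist (x :: finseq) y = norm (x - y)"

definition uniformity_finseq :: "(finseq \<times> finseq) filter" where
  "uniformity = (INF e\<in>{0 <..}. principal {(x :: finseq, y). dist x y < e})"

definition open_finseq :: "finseq set \<Rightarrow> bool" where
  "open (U :: finseq set) = (\<forall>x\<in>U. eventually (\<lambda>(x', y). x' = x \<longrightarrow> y \<in> U) uniformity)"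

lemma inner_finseq_superset:
  assumes "finite A" "{i. coord x i \<noteq> 0} \<subseteq> A"
  shows "inner x y = (\<Sum>i\<in>A. coord x i * coord y i)"
  unfolding inner_finseq_def using assms by (intro sum.mono_neutral_left) auto

instance
proof
  fix x y z :: finseq and r :: real
  let ?A = "{i. coord x i \<noteq> 0} \<union> {i. coord y i \<noteq> 0}"
  show "inner x y = inner y x"
    using inner_finseq_superset[of ?A x y] inner_finseq_superset[of ?A y x]
    by (simp add: mult.commute)
  have "inner (x + y) z = (\<Sum>i\<in>?A. coord (x + y) i * coord z i)"
    by (rule inner_finseq_superset) auto
  moreover have "inner x z = (\<Sum>i\<in>?A. coord x i * coord z i)"
    by (rule inner_finseq_superset) auto
  moreover have "inner y z = (\<Sum>i\<in>?A. coord y i * coord z i)"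
    by (rule inner_finseq_superset) auto
  ultimately show "inner (x + y) z = inner x z + inner y z"
    by (simp add: sum.distrib algebra_simps)
  have "inner (r *\<^sub>R x) y = (\<Sum>i\<in>?A. coord (r *\<^sub>R x) i * coord y i)"
    by (rule inner_finseq_superset) auto
  moreover have "inner x y = (\<Sum>i\<in>?A. coord x i * coord y i)"
    by (rule inner_finseq_superset) auto
  ultimately show "inner (r *\<^sub>R x) y = r * inner x y"
    by (simp add: sum_distrib_left algebra_simps)
  show "0 \<le> inner x x"
    unfolding inner_finseq_def by (intro sum_nonneg) simp
  show "(inner x x = 0) = (x = 0)"
    unfolding inner_finseq_def by (subst sum_nonneg_eq_0_iff) (auto simp: finseq_eq_iff)
qed (rule norm_finseq_def sgn_finseq_def dist_finseq_def uniformity_finseq_def open_finseq_def)+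

end

definition Rd :: "nat \<Rightarrow> finseq set" where
  "Rd d = {x. \<forall>i\<ge>d. coord x i = 0}"

lemma subspace_Rd: "subspace (Rd d)"
  by (auto simp: subspace_def Rd_def)

lemma inner_Rd: "x \<in> Rd d \<Longrightarrow> inner x y = (\<Sum>i<d. coord x i * coord y i)"
  by (rule inner_finseq_superset) (auto simp: Rd_def not_le[symmetric])

definition unit_vec :: "nat \<Rightarrow> finseq" where
  "unit_vec k = Finseq (\<lambda>i. if i = k then 1 else 0)"

lemma coord_unit_vec [simp]: "coord (unit_vec k) i = (if i = k then 1 else 0)"
  by (simp add: unit_vec_def coord_Finseq)

lemma unit_vec_in_Rd: "k < d \<Longrightarrow> unit_vec k \<in> Rd d"
  by (auto simp: Rd_def)

lemma Rd_expansion: "x \<in> Rd d \<Longrightarrow> x = (\<Sum>k<d. coord x k *\<^sub>R unit_vec k)"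
  by (auto simp: Rd_def finseq_eq_iff if_distrib cong: if_cong)

definition is_grad :: "nat \<Rightarrow> (finseq \<Rightarrow> real) \<Rightarrow> finseq \<Rightarrow> finseq \<Rightarrow> bool" where
  "is_grad d f x g \<longleftrightarrow> g \<in> Rd d \<and> (f has_derivative (\<lambda>h. inner g h)) (at x within Rd d)"

definition grad :: "nat \<Rightarrow> (finseq \<Rightarrow> real) \<Rightarrow> finseq \<Rightarrow> finseq" where
  "grad d f x = (THE g. is_grad d f x g)"

lemma is_grad_unique:
  assumes "x \<in> Rd d" "is_grad d f x g" "is_grad d f x g'"
  shows "g = g'"
proof -
  have diff: "g - g' \<in> Rd d"
    using assms subspace_diff[OF subspace_Rd] by (auto simp: is_grad_def)
  have *: "((\<lambda>x. 0::real) has_derivative (\<lambda>h. inner (g - g') h)) (at x within Rd d)"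
    using has_derivative_diff[of f "\<lambda>h. inner g h" _ f "\<lambda>h. inner g' h"] assms(2,3)
    by (simp add: is_grad_def inner_diff_left)
  define c where "c = (\<lambda>t::real. x + t *\<^sub>R (g - g'))"
  have c: "(c has_derivative (\<lambda>t. t *\<^sub>R (g - g'))) (at 0)"
    unfolding c_def by (auto intro!: derivative_eq_intros)
  have sub: "c ` UNIV \<subseteq> Rd d"
    using diff assms(1) subspace_Rd by (auto simp: c_def subspace_def)
  have "((\<lambda>x. 0::real) has_derivative (\<lambda>h. inner (g - g') h)) (at (c 0) within range c)"
    using has_derivative_subset[OF * sub] by (simp add: c_def)
  from has_derivative_in_compose[OF c this]
  have "((\<lambda>t::real. 0::real) has_derivative (\<lambda>t. inner (g - g') (t *\<^sub>R (g - g')))) (at 0)"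
    by simp
  then have "(\<lambda>t. inner (g - g') (t *\<^sub>R (g - g'))) = (\<lambda>t::real. 0)"
    using has_derivative_unique[OF _ has_derivative_const] by blast
  from fun_cong[OF this, of 1] show ?thesis by simp
qed

lemma is_grad_exists:
  assumes "f differentiable (at x within Rd d)" and x: "x \<in> Rd d"
  shows "\<exists>g. is_grad d f x g"
proof -
  obtain L where L: "(f has_derivative L) (at x within Rd d)"
    using assms by (auto simp: differentiable_def)
  interpret L: bounded_linear L using L by (rule has_derivative_bounded_linear)
  define g where "g = (\<Sum>k<d. L (unit_vec k) *\<^sub>R unit_vec k)"
  have coord_g: "coord g i = (if i < d then L (unit_vec i) else 0)" for i
    by (simp add: g_def if_distrib cong: if_cong)
  have g: "g \<in> Rd d" by (simp add: Rd_def coord_g)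
  have eq: "L h = inner g h" if "h \<in> Rd d" for h
  proof -
    have "L h = L (\<Sum>k<d. coord h k *\<^sub>R unit_vec k)" using Rd_expansion[OF that] by simp
    also have "\<dots> = inner g h"
      by (simp add: L.sum L.scaleR inner_Rd[OF g] coord_g mult.commute)
    finally show ?thesis .
  qed
  have "(f has_derivative (\<lambda>h. inner g h)) (at x within Rd d)"
    unfolding has_derivative_within
  proof (intro conjI)
    show "bounded_linear (\<lambda>h. inner g h)" by (rule bounded_linear_inner_right)
    have "\<forall>\<^sub>F y in at x within Rd d.
        (1 / norm (y - x)) *\<^sub>R (f y - (f x + L (y - x)))
          = (1 / norm (y - x)) *\<^sub>R (f y - (f x + inner g (y - x)))"
      using eq subspace_diff[OF subspace_Rd _ x]
      by (auto simp: eventually_at_filter)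
    moreover have "((\<lambda>y. (1 / norm (y - x)) *\<^sub>R (f y - (f x + L (y - x)))) \<longlongrightarrow> 0)
        (at x within Rd d)"
      using L by (simp add: has_derivative_within)
    ultimately show "((\<lambda>y. (1 / norm (y - x)) *\<^sub>R (f y - (f x + inner g (y - x)))) \<longlongrightarrow> 0)
        (at x within Rd d)"
      by (rule Lim_transform_eventually[rotated])
  qed
  with g show ?thesis by (auto simp: is_grad_def)
qed

lemma is_grad_grad:
  assumes "f differentiable_on Rd d" "x \<in> Rd d"
  shows "is_grad d f x (grad d f x)"
  unfolding grad_def
  by (rule theI') (metis assms differentiable_on_def is_grad_exists is_grad_unique)

definition strongly_convex_class :: "real \<Rightarrow> nat \<Rightarrow> (finseq \<Rightarrow> real) set" where
  "strongly_convex_class \<mu> d =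
    {f. f differentiable_on Rd d \<and>
        (\<forall>x\<in>Rd d. \<forall>y\<in>Rd d.
           f x \<ge> f y + inner (grad d f y) (x - y) + \<mu> / 2 * (norm (x - y))\<^sup>2)}"

text \<open>Trajectories live on \<open>[0, \<infinity>)\<close>; the derivative at time 0 is one-sided.\<close>

definition gradient_flow :: "nat \<Rightarrow> (finseq \<Rightarrow> real) \<Rightarrow> (real \<Rightarrow> finseq) \<Rightarrow> bool" where
  "gradient_flow d f X \<longleftrightarrow>
    (\<forall>t\<ge>0. X t \<in> Rd d \<and> (X has_vector_derivative - grad d f (X t)) (at t within {0..}))"

definition lyapunov ::
  "real \<Rightarrow> real \<Rightarrow> (finseq \<Rightarrow> real) \<Rightarrow> finseq \<Rightarrow> finseq \<Rightarrow> real" where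
  "lyapunov a c f xstar x = a * (f x - f xstar) + c * (norm (x - xstar))\<^sup>2"

definition neg_semidefinite :: "real ^ 'n ^ 'n \<Rightarrow> bool" where
  "neg_semidefinite M \<longleftrightarrow> transpose M = M \<and> (\<forall>v. inner v (M *v v) \<le> 0)"

end

theory Submission
  imports Defs
begin

text \<open>
  Along the flow, with \<open>x = X t - xstar\<close>, \<open>g = grad f (X t)\<close> and \<open>F = f (X t) - f xstar\<close>, decay at
  rate \<open>\<tau>\<close> reads \<open>\<tau> a F + \<tau> c |x|\<^sup>2 - 2 c \<langle>g, x\<rangle> - a |g|\<^sup>2 \<le> 0\<close>. The multipliers \<open>l1\<close> and \<open>l2\<close> weight
  the strong convexity inequalities \<open>F \<le> \<langle>g, x\<rangle> - \<mu>/2 |x|\<^sup>2\<close> and \<open>F \<ge> \<mu>/2 |x|\<^sup>2\<close>, and the matrix is that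
  of the quadratic form in \<open>(x, g)\<close> that remains.

  Conversely, dimension one suffices. For \<open>p \<ge> \<mu>\<close> the Huber regularization of
  \<open>\<mu>/2 y\<^sup>2 + (p - \<mu>) |y|\<close> at \<open>y = 1\<close> has \<open>g = p\<close> and \<open>F\<close> arbitrarily close to its upper bound
  \<open>p - \<mu>/2\<close>. This yields a concave quadratic in \<open>p\<close> that is nonpositive on \<open>p \<ge> \<mu>\<close>, and \<open>l2\<close> is
  the positive part of minus its slope at \<open>\<mu>\<close>.
\<close>

section \<open>Quadratic forms in two variables\<close>

lemma neg_semidefinite_2:
  "neg_semidefinite (vector [vector [p, q], vector [q, r]] :: real ^ 2 ^ 2) \<longleftrightarrow>
    (\<forall>u v. p * u\<^sup>2 + 2 * q * u * v + r * v\<^sup>2 \<le> 0)"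
  (is "neg_semidefinite ?M \<longleftrightarrow> ?R")
proof -
  have tr: "transpose ?M = ?M"
    by (simp add: vec_eq_iff transpose_def forall_2)
  have quad: "inner v (?M *v v) = p * (v $ 1)\<^sup>2 + 2 * q * (v $ 1) * (v $ 2) + r * (v $ 2)\<^sup>2" for v
    by (simp add: inner_vec_def matrix_vector_mult_def sum_2 power2_eq_square algebra_simps)
  show ?thesis
    unfolding neg_semidefinite_def quad
  proof (intro iffI conjI allI tr)
    fix u v :: real
    assume "transpose ?M = ?M \<and>
      (\<forall>v :: real ^ 2. p * (v $ 1)\<^sup>2 + 2 * q * (v $ 1) * (v $ 2) + r * (v $ 2)\<^sup>2 \<le> 0)"
    from this[THEN conjunct2, THEN spec, of "vector [u, v]"]
    show "p * u\<^sup>2 + 2 * q * u * v + r * v\<^sup>2 \<le> 0" by simp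
  qed simp
qed

text \<open>For \<open>x \<noteq> 0\<close>, split \<open>g\<close> into its projection
  \<open>m *\<^sub>R x\<close> and a part orthogonal to \<open>x\<close>. The projection contributes
  the scalar form at \<open>(1, m)\<close>, scaled by \<open>inner x x\<close>; the orthogonal part
  contributes \<open>r\<close> times a nonnegative number, and \<open>r \<le> 0\<close>.\<close>

lemma quadratic_form_nonpos_cauchy_schwarz:
  fixes x g :: "'a :: real_inner"
  assumes "\<And>u v. p * u\<^sup>2 + 2 * q * u * v + r * v\<^sup>2 \<le> (0::real)"
  shows "p * inner x x + 2 * q * inner g x + r * inner g g \<le> 0"
proof (cases "x = 0")
  case True
  then show ?thesis using assms[of 0 1] by (simp add: mult_nonpos_nonneg)
next
  case False
  define m where "m = inner g x / inner x x"
  have pos: "inner x x > 0" using False by simp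
  have "p + 2 * q * m + r * m\<^sup>2 \<le> 0" using assms[of 1 m] by simp
  then have "(p + 2 * q * m + r * m\<^sup>2) * inner x x \<le> 0"
    using pos by (simp add: mult_nonpos_nonneg)
  moreover have "(p + 2 * q * m + r * m\<^sup>2) * inner x x
      = p * inner x x + 2 * q * inner g x + r * (m * inner g x)"
    using pos by (simp add: m_def power2_eq_square field_simps)
  moreover have "r * inner g g \<le> r * (m * inner g x)"
  proof (rule mult_left_mono_neg)
    show "m * inner g x \<le> inner g g"
      using Cauchy_Schwarz_ineq[of g x] pos
      by (simp add: m_def power2_eq_square divide_le_eq)
    show "r \<le> 0" using assms[of 0 1] by simp
  qed
  ultimately show ?thesis by linarith
qed

section \<open>Sufficiency: from the matrix inequality to decay\<close>

text \<open>On the line through \<open>z\<close> in direction \<open>g\<close>, which stays in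
  \<open>Rd d\<close>, the derivative of \<open>f\<close> at \<open>z\<close> is
  \<open>inner g g\<close>; minimality makes it zero.\<close>

lemma is_grad_minimizer:
  assumes "is_arg_min f (\<lambda>x. x \<in> Rd d) z" "is_grad d f z g"
  shows "g = 0"
proof -
  have z: "z \<in> Rd d" and min: "\<And>y. y \<in> Rd d \<Longrightarrow> f z \<le> f y"
    using assms(1) by (auto simp: is_arg_min_linorder)
  have g: "g \<in> Rd d" and der: "(f has_derivative inner g) (at z within Rd d)"
    using assms(2) by (auto simp: is_grad_def)
  define c where "c = (\<lambda>t::real. z + t *\<^sub>R g)"
  have c: "(c has_derivative (\<lambda>t. t *\<^sub>R g)) (at 0)"
    unfolding c_def by (auto intro!: derivative_eq_intros)
  have sub: "range c \<subseteq> Rd d"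
    using g z subspace_Rd by (auto simp: c_def subspace_def)
  have "(f has_derivative inner g) (at (c 0) within range c)"
    using has_derivative_subset[OF der sub] by (simp add: c_def)
  from has_derivative_in_compose[OF c this]
  have "((\<lambda>t. f (c t)) has_real_derivative inner g g) (at 0)"
    unfolding has_field_derivative_def
    by (rule has_derivative_eq_rhs) (simp add: fun_eq_iff)
  then have "inner g g = 0"
    by (rule DERIV_local_min[where d = 1]) (use sub min in \<open>auto simp: c_def image_subset_iff\<close>)
  then show ?thesis by simp
qed

lemma has_real_derivative_lyapunov_flow:
  assumes "gradient_flow d f X" "f differentiable_on Rd d" "t \<ge> 0"
  shows "((\<lambda>s. lyapunov a c f z (X s)) has_real_derivative
      - a * inner (grad d f (X t)) (grad d f (X t)) - 2 * c * inner (grad d f (X t)) (X t - z))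
    (at t within {0..})"
proof -
  define g where "g = grad d f (X t)"
  have X: "X s \<in> Rd d" if "s \<ge> 0" for s
    using assms(1) that by (auto simp: gradient_flow_def)
  have dX: "(X has_derivative (\<lambda>s. s *\<^sub>R (- g))) (at t within {0..})"
    using assms(1,3) by (auto simp: gradient_flow_def has_vector_derivative_def g_def)
  have "(f has_derivative inner g) (at (X t) within Rd d)"
    using is_grad_grad[OF assms(2) X[OF assms(3)]] by (simp add: is_grad_def g_def)
  \<comment> \<open>The chain rule asks for the derivative of \<open>f\<close> within the image of
    the trajectory, which lies in \<open>Rd d\<close>.\<close>
  then have "(f has_derivative inner g) (at (X t) within X ` {0..})"
    by (rule has_derivative_subset) (auto simp: X)
  from has_derivative_in_compose[OF dX this]
  have df: "((\<lambda>s. f (X s)) has_derivative (\<lambda>s. inner g (s *\<^sub>R (- g)))) (at t within {0..})" .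
  have dn: "((\<lambda>s. inner (X s - z) (X s - z)) has_derivative
      (\<lambda>s. 2 * inner (X t - z) (s *\<^sub>R (- g)))) (at t within {0..})"
    by (rule derivative_eq_intros dX refl | simp add: inner_commute)+
  have "((\<lambda>s. lyapunov a c f z (X s)) has_derivative
      (\<lambda>s. a * inner g (s *\<^sub>R (- g)) + c * (2 * inner (X t - z) (s *\<^sub>R (- g))))) (at t within {0..})"
    unfolding lyapunov_def power2_norm_eq_inner
    by (rule derivative_eq_intros df dn refl | simp)+
  then show ?thesis
    unfolding has_field_derivative_def g_def[symmetric]
    by (rule has_derivative_eq_rhs) (simp add: fun_eq_iff inner_commute algebra_simps)
qed

lemma lyapunov_decay:
  assumes "\<And>u v. (\<tau> * c - \<mu> / 2 * (l1 + l2)) * u\<^sup>2 + 2 * (- c + l1 / 2) * u * v + (- a) * v\<^sup>2 \<le> 0"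
    and "l1 \<ge> 0" "l2 \<ge> 0" and ta: "\<tau> * a = l1 - l2"
    and f: "f \<in> strongly_convex_class \<mu> d" and z: "is_arg_min f (\<lambda>x. x \<in> Rd d) z"
    and x: "x \<in> Rd d"
  shows "- a * inner (grad d f x) (grad d f x) - 2 * c * inner (grad d f x) (x - z)
    \<le> - \<tau> * lyapunov a c f z x"
proof -
  define g where "g = grad d f x"
  define n where "n = inner (x - z) (x - z)"
  define m where "m = inner g (x - z)"
  have diff: "f differentiable_on Rd d"
    and sc: "\<And>x y. x \<in> Rd d \<Longrightarrow> y \<in> Rd d \<Longrightarrow>
      f x \<ge> f y + inner (grad d f y) (x - y) + \<mu> / 2 * (norm (x - y))\<^sup>2"
    using f by (auto simp: strongly_convex_class_def)
  have zR: "z \<in> Rd d" using z by (auto simp: is_arg_min_def)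
  have "grad d f z = 0"
    using is_grad_minimizer[OF z is_grad_grad[OF diff zR]] .
  then have "f x - f z \<ge> \<mu> / 2 * n"
    using sc[OF x zR] by (simp add: n_def power2_norm_eq_inner)
  then have 1: "l2 * (\<mu> / 2 * n - (f x - f z)) \<le> 0"
    using \<open>l2 \<ge> 0\<close> by (simp add: mult_nonneg_nonpos)
  have "inner g (z - x) = - m" "inner (z - x) (z - x) = n"
    by (simp_all add: m_def n_def inner_diff_left inner_diff_right)
  then have "f x - f z - m + \<mu> / 2 * n \<le> 0"
    using sc[OF zR x] by (simp add: g_def power2_norm_eq_inner)
  then have 2: "l1 * (f x - f z - m + \<mu> / 2 * n) \<le> 0"
    using \<open>l1 \<ge> 0\<close> by (simp add: mult_nonneg_nonpos)
  have 3: "(\<tau> * c - \<mu> / 2 * (l1 + l2)) * n + 2 * (- c + l1 / 2) * m + (- a) * inner g g \<le> 0"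
    unfolding n_def m_def by (rule quadratic_form_nonpos_cauchy_schwarz[OF assms(1)])
  \<comment> \<open>The gap in the decay inequality is the sum of the matrix form at
    \<open>(x - z, g)\<close>, the convexity inequalities in both directions between
    \<open>x\<close> and \<open>z\<close>, weighted by \<open>l1\<close> and \<open>l2\<close>, and
    a last term that \<open>ta\<close> makes zero.\<close>
  have "\<tau> * (a * (f x - f z) + c * n) - 2 * c * m - a * inner g g
      = ((\<tau> * c - \<mu> / 2 * (l1 + l2)) * n + 2 * (- c + l1 / 2) * m + (- a) * inner g g)
        + l1 * (f x - f z - m + \<mu> / 2 * n) + l2 * (\<mu> / 2 * n - (f x - f z))
        + (\<tau> * a - (l1 - l2)) * (f x - f z)"
    by (simp add: field_simps)
  then show ?thesis
    using 1 2 3 ta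
    by (simp add: lyapunov_def power2_norm_eq_inner g_def[symmetric] n_def[symmetric]
        m_def[symmetric])
qed

section \<open>From a scalar inequality to the multipliers\<close>

text \<open>Lagrange duality for the constraint \<open>p \<ge> \<mu>\<close>: after expansion around
  \<open>\<mu>\<close>, the multiplier cancels a negative slope there, and a nonnegative slope needs
  no correction.\<close>

lemma multiplier_exists:
  fixes a b q \<mu> :: real
  assumes "a \<ge> 0" and "\<And>p. p \<ge> \<mu> \<Longrightarrow> - a * p\<^sup>2 + b * p + q \<le> 0"
  obtains l where "l \<ge> 0" "\<And>p. - a * p\<^sup>2 + b * p + q + l * (p - \<mu>) \<le> 0"
proof
  define s where "s = b - 2 * a * \<mu>"
  show "max 0 (- s) \<ge> 0" by simp
  fix p :: real
  have exp: "- a * p\<^sup>2 + b * p + q = (- a * \<mu>\<^sup>2 + b * \<mu> + q) + s * (p - \<mu>) - a * (p - \<mu>)\<^sup>2" for p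
    by (simp add: s_def power2_eq_square algebra_simps)
  show "- a * p\<^sup>2 + b * p + q + max 0 (- s) * (p - \<mu>) \<le> 0"
  \<comment> \<open>In the first case the multiplier is zero and the hypothesis applies at
    \<open>p\<close>. Otherwise the corrected linear term is nonpositive, so the hypothesis at
    \<open>\<mu>\<close> suffices.\<close>
  proof (cases "s > 0 \<and> p \<ge> \<mu>")
    case True
    then show ?thesis using assms(2)[of p] by simp
  next
    case False
    then have "(s + max 0 (- s)) * (p - \<mu>) \<le> 0"
      by (cases "s > 0") (auto simp: max_def mult_nonneg_nonpos)
    then have "s * (p - \<mu>) + max 0 (- s) * (p - \<mu>) \<le> 0" by (simp only: distrib_right)
    moreover have "- a * \<mu>\<^sup>2 + b * \<mu> + q \<le> 0" "a * (p - \<mu>)\<^sup>2 \<ge> 0"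
      using assms by auto
    ultimately show ?thesis using exp[of p] by linarith
  qed
qed

text \<open>Homogenization with \<open>p = v / u\<close>; on the line \<open>u = 0\<close> only the
  sign of \<open>a\<close> matters.\<close>

lemma lmi_of_scalar_condition:
  assumes "\<And>p. - a * p\<^sup>2 + 2 * q * p + r \<le> (0::real)" "a \<ge> 0"
  shows "r * u\<^sup>2 + 2 * q * u * v + (- a) * v\<^sup>2 \<le> 0"
proof (cases "u = 0")
  case False
  have "(- a * (v / u)\<^sup>2 + 2 * q * (v / u) + r) * u\<^sup>2 \<le> 0"
    by (intro mult_nonpos_nonneg assms) simp
  moreover have "(- a * (v / u)\<^sup>2 + 2 * q * (v / u) + r) * u\<^sup>2 = r * u\<^sup>2 + 2 * q * u * v + (- a) * v\<^sup>2"
    using False by (simp add: power2_eq_square field_simps)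
  ultimately show ?thesis by simp
qed (use assms in simp)

section \<open>The Huber function\<close>

definition clamp1 :: "real \<Rightarrow> real" where
  "clamp1 s = max (-1) (min 1 s)"

definition huber :: "real \<Rightarrow> real \<Rightarrow> real" where
  "huber e y = clamp1 (y / e) * y - e / 2 * (clamp1 (y / e))\<^sup>2"

text \<open>The Huber function is the supremum over \<open>\<bar>s\<bar> \<le> 1\<close> of the affine functions
  \<open>\<lambda>y. s * y - e / 2 * s\<^sup>2\<close>, attained at \<open>s = clamp1 (y / e)\<close>.\<close>

lemma huber_ge_affine:
  assumes "e > 0" "\<bar>s\<bar> \<le> 1"
  shows "s * y - e / 2 * s\<^sup>2 \<le> huber e y"
proof -
  define w where "w = y / e"
  have y: "y = e * w" using assms by (simp add: w_def)
  \<comment> \<open>Variational inequality for \<open>clamp1 w\<close> as the projection of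
    \<open>w\<close> onto \<open>[-1, 1]\<close>.\<close>
  have "(s - clamp1 w) * (w - clamp1 w) \<le> 0"
    using assms by (auto simp: clamp1_def max_def min_def intro: mult_nonneg_nonpos mult_nonpos_nonneg)
  moreover have "(s - clamp1 w)\<^sup>2 \<ge> 0" by simp
  ultimately have "s * w - s\<^sup>2 / 2 \<le> clamp1 w * w - (clamp1 w)\<^sup>2 / 2"
    by (simp add: power2_eq_square algebra_simps)
  from mult_left_mono[OF this, of e] assms show ?thesis
    unfolding huber_def w_def[symmetric] y by (simp add: algebra_simps)
qed

lemma abs_clamp1_le: "\<bar>clamp1 s\<bar> \<le> 1"
  by (auto simp: clamp1_def)

text \<open>The affine function with \<open>s = clamp1 (y / e)\<close> lies below
  \<open>huber e\<close> and touches it at \<open>y\<close>.\<close>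

lemma huber_tangent:
  assumes "e > 0"
  shows "huber e y + clamp1 (y / e) * (x - y) \<le> huber e x"
  using huber_ge_affine[OF assms abs_clamp1_le, of "y / e" x]
  by (simp add: huber_def algebra_simps)

text \<open>The tangent at \<open>y\<close> bounds the remainder below by zero, and the tangent at
  \<open>x\<close> bounds it above by the slope difference times \<open>x - y\<close>. As
  \<open>clamp1\<close> is 1-Lipschitz, the remainder is quadratic in \<open>x - y\<close>, with no
  case split on the pieces of \<open>huber\<close>.\<close>

lemma has_real_derivative_huber:
  assumes "e > 0"
  shows "(huber e has_real_derivative clamp1 (y / e)) (at y)"
proof -
  let ?s = "clamp1 (y / e)"
  let ?r = "\<lambda>x. huber e x - (huber e y + ?s * (x - y))"
  have bound: "\<bar>?r x\<bar> \<le> \<bar>x - y\<bar>\<^sup>2 / e" for x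
  proof -
    have "\<bar>clamp1 (x / e) - ?s\<bar> \<le> \<bar>x / e - y / e\<bar>"
      by (auto simp: clamp1_def max_def min_def)
    then have "\<bar>clamp1 (x / e) - ?s\<bar> * \<bar>x - y\<bar> \<le> \<bar>x / e - y / e\<bar> * \<bar>x - y\<bar>"
      by (rule mult_right_mono) simp
    moreover have "\<bar>x / e - y / e\<bar> = \<bar>x - y\<bar> / e"
      using assms by (simp add: diff_divide_distrib[symmetric])
    ultimately have "(clamp1 (x / e) - ?s) * (x - y) \<le> \<bar>x - y\<bar>\<^sup>2 / e"
      using abs_le_D1[of "(clamp1 (x / e) - ?s) * (x - y)"]
      by (simp add: abs_mult power2_eq_square)
    then show ?thesis
      using huber_tangent[OF assms, of y x] huber_tangent[OF assms, of x y]
      by (simp add: algebra_simps)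
  qed
  have "((\<lambda>x. (1 / norm (x - y)) *\<^sub>R ?r x) \<longlongrightarrow> 0) (at y)"
  proof (rule Lim_null_comparison)
    show "\<forall>\<^sub>F x in at y. norm ((1 / norm (x - y)) *\<^sub>R ?r x) \<le> \<bar>x - y\<bar> / e"
      using bound by (auto simp: eventually_at_filter field_simps power2_eq_square)
    show "((\<lambda>x. \<bar>x - y\<bar> / e) \<longlongrightarrow> 0) (at y)"
      by (rule tendsto_eq_intros refl | use assms in simp)+
  qed
  then show ?thesis
    by (simp add: has_field_derivative_def has_derivative_within bounded_linear_mult_right
        del: real_scaleR_def)
qed

section \<open>Transfer of functions on the real line to \<open>Rd 1\<close>\<close>

lemma coord_eq_inner_unit_vec: "coord x k = inner (unit_vec k) x"
  by (subst inner_finseq_superset[of "{k}"]) auto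

lemma bounded_linear_coord: "bounded_linear (\<lambda>x. coord x k)"
  unfolding coord_eq_inner_unit_vec by (rule bounded_linear_inner_right)

lemma Rd_1_eq: "x \<in> Rd 1 \<Longrightarrow> x = coord x 0 *\<^sub>R unit_vec 0"
  by (drule Rd_expansion) simp

lemma inner_unit_vec_self [simp]: "inner (unit_vec k) (unit_vec k) = 1"
  by (simp flip: coord_eq_inner_unit_vec)

lemma norm_unit_vec [simp]: "norm (unit_vec k) = 1"
  by (simp add: norm_eq_sqrt_inner)

lemma is_grad_coord:
  assumes "(\<phi> has_real_derivative D) (at (coord x 0))"
  shows "is_grad 1 (\<lambda>x. \<phi> (coord x 0)) x (D *\<^sub>R unit_vec 0)"
  unfolding is_grad_def
proof
  show "D *\<^sub>R unit_vec 0 \<in> Rd 1" by (simp add: Rd_def)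
  have "((\<lambda>x. coord x 0) has_derivative (\<lambda>x. coord x 0)) (at x within Rd 1)"
    by (rule bounded_linear_imp_has_derivative[OF bounded_linear_coord])
  from has_derivative_compose[OF this assms[unfolded has_field_derivative_def]]
  show "((\<lambda>x. \<phi> (coord x 0)) has_derivative inner (D *\<^sub>R unit_vec 0)) (at x within Rd 1)"
    by (rule has_derivative_eq_rhs) (simp add: fun_eq_iff coord_eq_inner_unit_vec)
qed

lemma strongly_convex_class_coord:
  assumes der: "\<And>y. (\<phi> has_real_derivative \<phi>' y) (at y)"
    and conv: "\<And>x y. \<phi> x \<ge> \<phi> y + \<phi>' y * (x - y) + \<mu> / 2 * (x - y)\<^sup>2"
  shows "(\<lambda>x. \<phi> (coord x 0)) \<in> strongly_convex_class \<mu> 1"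
    and "x \<in> Rd 1 \<Longrightarrow> grad 1 (\<lambda>x. \<phi> (coord x 0)) x = \<phi>' (coord x 0) *\<^sub>R unit_vec 0"
proof -
  have grad: "grad 1 (\<lambda>x. \<phi> (coord x 0)) x = \<phi>' (coord x 0) *\<^sub>R unit_vec 0" if "x \<in> Rd 1" for x
    unfolding grad_def using is_grad_coord[OF der] is_grad_unique[OF that] by (blast intro: the_equality)
  then show "x \<in> Rd 1 \<Longrightarrow> grad 1 (\<lambda>x. \<phi> (coord x 0)) x = \<phi>' (coord x 0) *\<^sub>R unit_vec 0" .
  have "(\<lambda>x. \<phi> (coord x 0)) differentiable_on Rd 1"
    using is_grad_coord[OF der] by (auto simp: differentiable_on_def differentiable_def is_grad_def)
  moreover have "\<phi> (coord x 0) \<ge> \<phi> (coord y 0) + inner (grad 1 (\<lambda>x. \<phi> (coord x 0)) y) (x - y)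
      + \<mu> / 2 * (norm (x - y))\<^sup>2" if "x \<in> Rd 1" "y \<in> Rd 1" for x y
  proof -
    have "x - y = (coord x 0 - coord y 0) *\<^sub>R unit_vec 0"
      using Rd_1_eq[OF that(1)] Rd_1_eq[OF that(2)] by (metis scaleR_left_diff_distrib)
    then have "norm (x - y) = \<bar>coord x 0 - coord y 0\<bar>" by simp
    then show ?thesis
      using conv[of "coord y 0" "coord x 0"] grad[OF that(2)]
      by (simp add: coord_eq_inner_unit_vec inner_diff_right right_diff_distrib)
  qed
  ultimately show "(\<lambda>x. \<phi> (coord x 0)) \<in> strongly_convex_class \<mu> 1"
    by (simp add: strongly_convex_class_def)
qed

section \<open>Necessity: the test trajectory and its limit\<close>

text \<open>The flow of \<open>\<mu> / 2 * y\<^sup>2 + k * huber e y\<close> is affine on each side of the level \<open>e\<close>, so the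
  trajectory from \<open>1\<close> consists of two exponentials meeting at the time when it reaches \<open>e\<close>.\<close>

lemma huber_flow_exists:
  fixes \<mu> k e :: real
  assumes "\<mu> > 0" "k \<ge> 0" "0 < e" "e < 1"
  obtains y :: "real \<Rightarrow> real" where "y 0 = 1"
    "\<And>t. t \<ge> 0 \<Longrightarrow>
      (y has_real_derivative - (\<mu> * y t + k * clamp1 (y t / e))) (at t within {0..})"
proof -
  \<comment> \<open>The solution of \<open>u T = e\<close>.\<close>
  define T where "T = ln ((\<mu> + k) / (\<mu> * e + k)) / \<mu>"
  define u where "u = (\<lambda>t. (1 + k / \<mu>) * exp (- \<mu> * t) - k / \<mu>)"
  define v where "v = (\<lambda>t. e * exp (- (\<mu> + k / e) * (t - T)))"
  define y where "y = (\<lambda>t. if t \<in> {0..T} then u t else v t)"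
  have pos: "\<mu> * e + k > 0" "\<mu> + k > 0" using assms by (auto intro: add_pos_nonneg)
  have "\<mu> * e + k < \<mu> + k" using assms by simp
  then have T: "T > 0" using pos assms by (simp add: T_def)
  have "exp (\<mu> * T) = (\<mu> + k) / (\<mu> * e + k)"
    using pos assms by (simp add: T_def)
  then have expT: "exp (- \<mu> * T) = (\<mu> * e + k) / (\<mu> + k)"
    by (simp add: exp_minus)
  have "u T = e"
  proof -
    have "1 + k / \<mu> = (\<mu> + k) / \<mu>" using assms by (simp add: add_divide_distrib)
    then have "u T = (\<mu> * e + k) / \<mu> - k / \<mu>" unfolding u_def expT using pos by simp
    then show ?thesis using assms by (simp add: add_divide_distrib)
  qed
  have u_ge: "u t \<ge> e" if "t \<le> T" for t
  proof -
    have "u T \<le> u t" unfolding u_def using that assms by (simp add: mult_left_mono)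
    then show ?thesis using \<open>u T = e\<close> by simp
  qed
  have v_bd: "0 \<le> v t \<and> v t \<le> e" if "t \<ge> T" for t
  proof -
    have "(- (\<mu> + k / e)) * (t - T) \<le> 0"
      using that assms by (intro mult_nonpos_nonneg) (auto intro!: add_nonneg_nonneg simp del: minus_add_distrib)
    then show ?thesis using assms by (simp add: v_def mult_le_cancel_left1)
  qed
  have du: "(u has_real_derivative - (\<mu> * u t + k * clamp1 (u t / e))) (at t within S)"
    if "t \<le> T" for t S
  proof -
    have "clamp1 (u t / e) = 1" using u_ge[OF that] assms by (simp add: clamp1_def)
    then have eq: "- (\<mu> * u t + k * clamp1 (u t / e)) = (1 + k / \<mu>) * (exp (- \<mu> * t) * (- \<mu>))"
      using assms by (simp add: u_def field_simps)
    show ?thesis unfolding eq unfolding u_def by (auto intro!: derivative_eq_intros)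
  qed
  have dv: "(v has_real_derivative - (\<mu> * v t + k * clamp1 (v t / e))) (at t within S)"
    if "t \<ge> T" for t S
  proof -
    have "0 \<le> v t / e" "v t / e \<le> 1" using v_bd[OF that] assms by auto
    then have "clamp1 (v t / e) = v t / e" by (simp add: clamp1_def)
    then have eq: "- (\<mu> * v t + k * clamp1 (v t / e)) = e * (exp (- (\<mu> + k / e) * (t - T)) * (- (\<mu> + k / e)))"
      using assms by (simp add: v_def field_simps)
    show ?thesis unfolding eq unfolding v_def by (auto intro!: derivative_eq_intros)
  qed
  have "v T = e" by (simp add: v_def)
  show ?thesis
  proof
    show "y 0 = 1" using T assms by (simp add: y_def u_def)
    fix t :: real assume "t \<ge> 0"
    \<comment> \<open>Both pieces solve the same autonomous equation and equal \<open>e\<close> at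
      \<open>T\<close>, so their derivatives also agree there.\<close>
    have "(y has_vector_derivative (if t \<in> {0..T} then - (\<mu> * u t + k * clamp1 (u t / e))
        else - (\<mu> * v t + k * clamp1 (v t / e)))) (at t within {0..})"
      unfolding y_def
    proof (rule has_vector_derivative_If_within_closures[where T = "{T<..}"])
      show "{0..} = {0..T} \<union> {T<..}" using T by auto
    qed (use \<open>t \<ge> 0\<close> \<open>u T = e\<close> \<open>v T = e\<close> du dv in
      \<open>auto simp: has_real_derivative_iff_has_vector_derivative\<close>)
    then show "(y has_real_derivative - (\<mu> * y t + k * clamp1 (y t / e))) (at t within {0..})"
      by (auto simp: has_real_derivative_iff_has_vector_derivative y_def split: if_splits)
  qed
qed

text \<open>Decay is tested only at time 0, on the flow started at coordinate 1. Since
  \<open>e < 1\<close>, this point lies on the linear part of \<open>huber e\<close>, so the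
  gradient has coordinate exactly \<open>p\<close>.\<close>

lemma scalar_condition_of_decay:
  assumes pos: "\<mu> > 0" "p \<ge> \<mu>" "0 < e" "e < 1"
    and decay: "\<And>f z X t. f \<in> strongly_convex_class \<mu> 1 \<Longrightarrow> is_arg_min f (\<lambda>x. x \<in> Rd 1) z \<Longrightarrow>
      gradient_flow 1 f X \<Longrightarrow> t \<ge> 0 \<Longrightarrow>
      \<exists>D. ((\<lambda>s. lyapunov a c f z (X s)) has_real_derivative D) (at t within {0..}) \<and>
        D \<le> - \<tau> * lyapunov a c f z (X t)"
  shows "- a * p\<^sup>2 - 2 * c * p + \<tau> * (a * (\<mu> / 2 + (p - \<mu>) * (1 - e / 2)) + c) \<le> 0"
proof -
  define k where "k = p - \<mu>"
  define \<phi> where "\<phi> = (\<lambda>y. \<mu> / 2 * y\<^sup>2 + k * huber e y)"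
  define \<phi>' where "\<phi>' = (\<lambda>y. \<mu> * y + k * clamp1 (y / e))"
  define f where "f = (\<lambda>x. \<phi> (coord x 0))"
  have k: "k \<ge> 0" using pos by (simp add: k_def)
  have der: "(\<phi> has_real_derivative \<phi>' y) (at y)" for y
    unfolding \<phi>_def \<phi>'_def using pos
    by (auto intro!: derivative_eq_intros has_real_derivative_huber)
  have conv: "\<phi> x \<ge> \<phi> y + \<phi>' y * (x - y) + \<mu> / 2 * (x - y)\<^sup>2" for x y
    using mult_left_mono[OF huber_tangent[OF pos(3), of y x] k]
    unfolding \<phi>_def \<phi>'_def by (simp add: power2_eq_square field_simps)
  note f = strongly_convex_class_coord[OF der conv, folded f_def]
  obtain y where y0: "y 0 = 1" and dy: "\<And>t. t \<ge> 0 \<Longrightarrow>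
      (y has_real_derivative - \<phi>' (y t)) (at t within {0..})"
    using huber_flow_exists[OF pos(1) k pos(3,4)] unfolding \<phi>'_def by blast
  define X where "X = (\<lambda>t. y t *\<^sub>R unit_vec 0)"
  have X: "X t \<in> Rd 1" "coord (X t) 0 = y t" for t by (auto simp: X_def Rd_def)
  have flow: "gradient_flow 1 f X"
    unfolding gradient_flow_def
  proof (intro allI impI conjI X)
    fix t :: real assume "t \<ge> 0"
    have "(X has_vector_derivative (- \<phi>' (y t)) *\<^sub>R unit_vec 0) (at t within {0..})"
      unfolding X_def
      using dy[OF \<open>t \<ge> 0\<close>] by (auto intro!: derivative_eq_intros)
    then show "(X has_vector_derivative - grad 1 f (X t)) (at t within {0..})"
      using f(2)[OF X(1)] by (simp add: X(2))
  qed
  have \<phi>0: "\<phi> 0 = 0" "\<phi>' 0 = 0" by (simp_all add: \<phi>_def \<phi>'_def huber_def clamp1_def)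
  have "\<phi> 0 \<le> \<phi> x" for x
  proof -
    have "\<mu> / 2 * x\<^sup>2 \<ge> 0" using pos by simp
    then show ?thesis using conv[of 0 x] \<phi>0 by simp
  qed
  then have argmin: "is_arg_min f (\<lambda>x. x \<in> Rd 1) 0"
    by (auto simp: is_arg_min_linorder f_def Rd_def)
  obtain D where D: "((\<lambda>s. lyapunov a c f 0 (X s)) has_real_derivative D) (at 0 within {0..})"
      "D \<le> - \<tau> * lyapunov a c f 0 (X 0)"
    using decay[OF f(1) argmin flow, of 0] by auto
  have "1 / e \<ge> 1" using pos by simp
  then have cl: "clamp1 (1 / e) = 1" by (simp add: clamp1_def)
  have \<phi>1: "\<phi> 1 = \<mu> / 2 + k * (1 - e / 2)" "\<phi>' 1 = p"
    by (simp_all add: \<phi>_def \<phi>'_def huber_def cl k_def)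
  have g: "grad 1 f (X 0) = p *\<^sub>R unit_vec 0" using f(2)[OF X(1)] by (simp add: X(2) y0 \<phi>1)
  have "f differentiable_on Rd 1" using f(1) by (simp add: strongly_convex_class_def)
  from has_real_derivative_lyapunov_flow[OF flow this, of 0 a c 0]
  have "((\<lambda>s. lyapunov a c f 0 (X s)) has_real_derivative - a * p\<^sup>2 - 2 * c * p) (at 0 within {0..})"
    unfolding g by (simp add: X_def y0 power2_eq_square)
  \<comment> \<open>Even a one-sided derivative at 0 is unique, which identifies the
    \<open>D\<close> supplied by \<open>decay\<close>.\<close>
  then have "D = - a * p\<^sup>2 - 2 * c * p"
    using D(1) by (intro has_field_derivative_unique[of _ _ 0 "{0..}"])
      (auto simp: at_within_Ici_at_right)
  with D(2) show ?thesis
    by (simp add: lyapunov_def f_def X y0 \<phi>0 \<phi>1 X_def k_def)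
qed

text \<open>For \<open>p > \<mu>\<close> the extremal function has a kink at 0 and is not itself
  admissible. The bound is therefore obtained by letting \<open>e\<close> tend to 0 from the
  right.\<close>

lemma scalar_condition_of_decay_limit:
  assumes pos: "\<mu> > 0" "p \<ge> \<mu>"
    and decay: "\<And>f z X t. f \<in> strongly_convex_class \<mu> 1 \<Longrightarrow> is_arg_min f (\<lambda>x. x \<in> Rd 1) z \<Longrightarrow>
      gradient_flow 1 f X \<Longrightarrow> t \<ge> 0 \<Longrightarrow>
      \<exists>D. ((\<lambda>s. lyapunov a c f z (X s)) has_real_derivative D) (at t within {0..}) \<and>
        D \<le> - \<tau> * lyapunov a c f z (X t)"
  shows "- a * p\<^sup>2 + (\<tau> * a - 2 * c) * p + \<tau> * (c - a * \<mu> / 2) \<le> 0"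
proof -
  let ?b = "\<lambda>e. - a * p\<^sup>2 - 2 * c * p + \<tau> * (a * (\<mu> / 2 + (p - \<mu>) * (1 - e / 2)) + c)"
  have "?b 0 \<le> 0"
  proof (rule tendsto_upperbound)
    show "(?b \<longlongrightarrow> ?b 0) (at_right 0)" by (intro tendsto_intros) simp
    show "\<forall>\<^sub>F e in at_right 0. ?b e \<le> 0"
      unfolding eventually_at_right_field
      using scalar_condition_of_decay[OF pos _ _ decay] by (intro exI[of _ 1]) auto
  qed simp
  then show ?thesis by (simp add: field_simps)
qed

theorem theorem2p1:
  fixes a c \<tau> \<mu> :: real
  assumes "a \<ge> 0" and "c \<ge> 0" and "\<tau> \<ge> 0" and "\<mu> > 0"
  shows "(\<forall>d::nat. \<forall>f \<in> strongly_convex_class \<mu> d. \<forall>xstar.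
            is_arg_min f (\<lambda>x. x \<in> Rd d) xstar \<longrightarrow>
            (\<forall>X. gradient_flow d f X \<longrightarrow>
              (\<forall>t\<ge>0. \<exists>D.
                ((\<lambda>s. lyapunov a c f xstar (X s)) has_real_derivative D) (at t within {0..}) \<and>
                D \<le> - \<tau> * lyapunov a c f xstar (X t))))
     \<longleftrightarrow>
         (\<exists>l1 l2. l1 \<ge> 0 \<and> l2 \<ge> 0 \<and>
            neg_semidefinite
              (vector [vector [\<tau> * c - \<mu> / 2 * (l1 + l2), - c + l1 / 2],
                       vector [- c + l1 / 2, - a]] :: real ^ 2 ^ 2) \<and>
            \<tau> * a = l1 - l2)"
  (is "?decay \<longleftrightarrow> ?lmi")
proof
  assume ?decay
  then have "- a * p\<^sup>2 + (\<tau> * a - 2 * c) * p + \<tau> * (c - a * \<mu> / 2) \<le> 0" if "p \<ge> \<mu>" for p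
    using that \<open>\<mu> > 0\<close> by (intro scalar_condition_of_decay_limit) blast+
  then obtain l where "l \<ge> 0"
    and l: "\<And>p. - a * p\<^sup>2 + (\<tau> * a - 2 * c) * p + \<tau> * (c - a * \<mu> / 2) + l * (p - \<mu>) \<le> 0"
    using multiplier_exists[OF \<open>a \<ge> 0\<close>] by metis
  \<comment> \<open>The same quadratic, regrouped to show the matrix entries for
    \<open>l1 = \<tau> * a + l\<close> and \<open>l2 = l\<close>.\<close>
  have "- a * p\<^sup>2 + 2 * (- c + (\<tau> * a + l) / 2) * p + (\<tau> * c - \<mu> / 2 * (\<tau> * a + l + l)) \<le> 0" for p
    using l[of p] by (simp add: field_simps)
  from lmi_of_scalar_condition[OF this \<open>a \<ge> 0\<close>]
  show ?lmi
    unfolding neg_semidefinite_2 using \<open>l \<ge> 0\<close> assms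
    by (intro exI[of _ "\<tau> * a + l"] exI[of _ l]) auto
next
  assume ?lmi
  then obtain l1 l2 where l: "l1 \<ge> 0" "l2 \<ge> 0" "\<tau> * a = l1 - l2"
    and neg: "\<And>u v. (\<tau> * c - \<mu> / 2 * (l1 + l2)) * u\<^sup>2 + 2 * (- c + l1 / 2) * u * v + (- a) * v\<^sup>2 \<le> 0"
    unfolding neg_semidefinite_2 by blast
  show ?decay
  proof (intro allI ballI impI)
    fix d f z X and t :: real
    assume f: "f \<in> strongly_convex_class \<mu> d" and z: "is_arg_min f (\<lambda>x. x \<in> Rd d) z"
      and X: "gradient_flow d f X" and t: "t \<ge> 0"
    have "f differentiable_on Rd d" "X t \<in> Rd d"
      using f X t by (auto simp: strongly_convex_class_def gradient_flow_def)
    then show "\<exists>D. ((\<lambda>s. lyapunov a c f z (X s)) has_real_derivative D) (at t within {0..}) \<and>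
        D \<le> - \<tau> * lyapunov a c f z (X t)"
      using has_real_derivative_lyapunov_flow[OF X _ t] lyapunov_decay[OF neg l f z] by blast
  qed
qed

end
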